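(* Let $N\ge 0$ be an integer and let $\widehat\Lambda_N$ be the Markov kernel from $\{0,\dots,N\}$ to itself given by $$\widehat\Lambda_N(x,y)=2^{x-N}\binom{N-x}{y-x},\qquad x,y\in\{0,\dots,N\},$$ (understood to be $0$ when $y<x$). Then for every $n\in\{0,\dots,N\}$, $$\widehat\Lambda_N[K_{N,n}]=2^{-n}\,n!\,\varphi_n,$$ and in particular $$D_N\widehat\Lambda_N=\widehat\Lambda_N L_N.$$
   Context: For an integer $N\ge 0$, the Ehrenfest generator $L_N$ is the $\{0,\dots,N\}\times\{0,\dots,N\}$ matrix whose off-diagonal entries are $L_N(x,x+1)=\frac{N-x}{2}$, $L_N(x,x-1)=\frac{x}{2}$, and $L_N(x,x')=0$ for $|x-x'|\ge 2$, and whose diagonal entries are such that all row sums vanish. The Yule (pure-death) generator $D_N$ is the $\{0,\dots,N\}\times\{0,\dots,N\}$ matrix with off-diagonal entries $D_N(x,x-1)=x$ and $D_N(x,x')=0$ for $x'\notin\{x,x-1\}$, and diagonal entries such that all row sums vanish. The Krawtchouk polynomials $K_{N,n}$, $n\in\{0,\dots,N\}$, are the functions on $\{0,\dots,N\}$ defined by $$\sum_{n=0}^N K_{N,n}(x)\frac{z^n}{n!}=\Big(1+\frac z2\Big)^x\Big(1-\frac z2\Big)^{N-x},\qquad x\in\{0,\dots,N\},\ z\in\mathbb{C}.$$ For $n\in\{0,\dots,N\}$, $\varphi_n(x)=\binom{x}{n}$ for $x\in\{0,\dots,N\}$, with $\binom{m}{n}=0$ for $m<n$. A kernel acts on functions by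 $\Lambda[f](x)=\sum_y\Lambda(x,y)f(y)$. *)

theory Defs
  imports
    Complex_Main
    "HOL-Computational_Algebra.Polynomial"
    "Jordan_Normal_Form.Matrix"
begin

definition generator_mat :: "nat \<Rightarrow> (nat \<Rightarrow> nat \<Rightarrow> real) \<Rightarrow> real mat" where
  "generator_mat N q = mat (N + 1) (N + 1)
     (\<lambda>(x, y). if x = y then - (\<Sum>y' \<in> {0..N} - {x}. q x y') else q x y)"

definition ehrenfest_generator :: "nat \<Rightarrow> real mat" where
  "ehrenfest_generator N = generator_mat N
     (\<lambda>x y. if y = x + 1 then (real N - real x) / 2
            else if x = y + 1 then real x / 2
            else 0)"

definition yule_generator :: "nat \<Rightarrow> real mat" where
  "yule_generator N = generator_mat N (\<lambda>x y. if x = y + 1 then real x else 0)"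

(* The values are determined by the generating function for x \<le> N and n \<le> N only; see
   krawtchouk_generating_function and krawtchouk_unique below. The clause on m > N merely makes
   the sequence of coefficients unique, so that THE applies. *)
definition krawtchouk :: "nat \<Rightarrow> nat \<Rightarrow> nat \<Rightarrow> real" where
  "krawtchouk N n x =
     (THE k :: nat \<Rightarrow> real. (\<forall>m>N. k m = 0) \<and>
        (\<forall>z::complex. (\<Sum>m = 0..N. complex_of_real (k m) * (z ^ m / fact m))
                      = (1 + z / 2) ^ x * (1 - z / 2) ^ (N - x))) n"

definition krawtchouk_vec :: "nat \<Rightarrow> nat \<Rightarrow> real vec" where
  "krawtchouk_vec N n = vec (N + 1) (krawtchouk N n)"

definition binomial_vec :: "nat \<Rightarrow> nat \<Rightarrow> real vec" where
  "binomial_vec N n = vec (N + 1) (\<lambda>x. real (x choose n))"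

definition markov_kernel :: "nat \<Rightarrow> real mat \<Rightarrow> bool" where
  "markov_kernel N A \<longleftrightarrow>
     A \<in> carrier_mat (N + 1) (N + 1) \<and>
     (\<forall>x\<in>{0..N}. (\<forall>y\<in>{0..N}. 0 \<le> A $$ (x, y)) \<and> (\<Sum>y = 0..N. A $$ (x, y)) = 1)"

(* The case distinction is needed because y - x truncates to 0 on nat. *)
definition Lambda_hat :: "nat \<Rightarrow> real mat" where
  "Lambda_hat N = mat (N + 1) (N + 1)
     (\<lambda>(x, y). if y < x then 0
               else 2 powi (int x - int N) * real ((N - x) choose (y - x)))"

lemma generator_mat_row_sum:
  assumes "x \<le> N"
  shows "(\<Sum>y = 0..N. generator_mat N q $$ (x, y)) = 0"
proof -
  have "(\<Sum>y = 0..N. generator_mat N q $$ (x, y))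
      = generator_mat N q $$ (x, x) + (\<Sum>y \<in> {0..N} - {x}. generator_mat N q $$ (x, y))"
    using assms by (intro sum.remove) auto
  also have "(\<Sum>y \<in> {0..N} - {x}. generator_mat N q $$ (x, y)) = (\<Sum>y \<in> {0..N} - {x}. q x y)"
    using assms by (intro sum.cong) (auto simp: generator_mat_def)
  finally show ?thesis
    using assms by (simp add: generator_mat_def)
qed

lemma generating_coeffs_eqI:
  fixes k l :: "nat \<Rightarrow> real"
  assumes eq: "\<And>z::complex. (\<Sum>m = 0..N. complex_of_real (k m) * (z ^ m / fact m))
                            = (\<Sum>m = 0..N. complex_of_real (l m) * (z ^ m / fact m))"
    and n: "n \<le> N"
  shows "k n = l n"
proof -
  define P where "P f = (\<Sum>m = 0..N. monom (complex_of_real (f m) / fact m) m)"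
    for f :: "nat \<Rightarrow> real"
  have poly_P: "poly (P f) z = (\<Sum>m = 0..N. complex_of_real (f m) * (z ^ m / fact m))" for f z
    by (simp add: P_def poly_sum poly_monom)
  have coeff_P: "coeff (P f) n = complex_of_real (f n) / fact n" for f
    using n by (simp add: P_def coeff_sum sum.delta if_distrib cong: if_cong)
  have "P k = P l"
    unfolding poly_eq_poly_eq_iff[symmetric] by (rule ext) (simp only: poly_P eq)
  then show ?thesis
    using coeff_P[of k] coeff_P[of l] by simp
qed

lemma krawtchouk_ex1:
  assumes "x \<le> N"
  shows "\<exists>!k :: nat \<Rightarrow> real. (\<forall>m>N. k m = 0) \<and>
        (\<forall>z::complex. (\<Sum>m = 0..N. complex_of_real (k m) * (z ^ m / fact m))
                      = (1 + z / 2) ^ x * (1 - z / 2) ^ (N - x))"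
proof (rule ex_ex1I)
  define p :: "real poly" where "p = [:1, 1/2:] ^ x * [:1, -1/2:] ^ (N - x)"
  have "degree p \<le> degree ([:1, 1/2:] ^ x :: real poly) + degree ([:1, -1/2:] ^ (N - x) :: real poly)"
    unfolding p_def by (rule degree_mult_le)
  also have "\<dots> \<le> N"
    using assms by (simp add: degree_power_eq)
  finally have deg: "degree p \<le> N" .
  have map_mult: "map_poly complex_of_real (a * b) = map_poly of_real a * map_poly of_real b" for a b
    by (rule poly_eqI) (simp add: coeff_map_poly coeff_mult)
  have map_power: "map_poly complex_of_real (a ^ n) = map_poly of_real a ^ n" for a n
    by (induction n) (simp_all add: map_mult)
  have map_p: "map_poly complex_of_real p = [:1, 1/2:] ^ x * [:1, -1/2:] ^ (N - x)"
    by (simp add: p_def map_mult map_power map_poly_pCons)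
  have "(\<Sum>m = 0..N. complex_of_real (coeff p m * fact m) * (z ^ m / fact m))
      = (1 + z / 2) ^ x * (1 - z / 2) ^ (N - x)" for z :: complex
  proof -
    have "poly (map_poly complex_of_real p) z = (\<Sum>m\<le>N. coeff (map_poly complex_of_real p) m * z ^ m)"
      unfolding poly_altdef using deg
      by (intro sum.mono_neutral_left) (auto simp: degree_map_poly coeff_map_poly coeff_eq_0)
    also have "\<dots> = (\<Sum>m = 0..N. complex_of_real (coeff p m * fact m) * (z ^ m / fact m))"
      by (intro sum.cong) (auto simp: coeff_map_poly)
    finally show ?thesis
      by (simp add: map_p)
  qed
  with deg show "\<exists>k :: nat \<Rightarrow> real. (\<forall>m>N. k m = 0) \<and>
        (\<forall>z::complex. (\<Sum>m = 0..N. complex_of_real (k m) * (z ^ m / fact m))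
                      = (1 + z / 2) ^ x * (1 - z / 2) ^ (N - x))"
    by (intro exI[of _ "\<lambda>m. coeff p m * fact m"]) (auto simp: coeff_eq_0)
next
  fix k l :: "nat \<Rightarrow> real"
  assume k: "(\<forall>m>N. k m = 0) \<and>
        (\<forall>z::complex. (\<Sum>m = 0..N. complex_of_real (k m) * (z ^ m / fact m))
                      = (1 + z / 2) ^ x * (1 - z / 2) ^ (N - x))"
    and l: "(\<forall>m>N. l m = 0) \<and>
        (\<forall>z::complex. (\<Sum>m = 0..N. complex_of_real (l m) * (z ^ m / fact m))
                      = (1 + z / 2) ^ x * (1 - z / 2) ^ (N - x))"
  show "k = l"
  proof
    fix n
    show "k n = l n"
    proof (cases "n \<le> N")
      case True
      with k l show ?thesis by (intro generating_coeffs_eqI[where N = N]) auto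
    next
      case False
      with k l show ?thesis by simp
    qed
  qed
qed

lemma krawtchouk_generating_function:
  assumes "x \<le> N"
  shows "(\<Sum>n = 0..N. complex_of_real (krawtchouk N n x) * (z ^ n / fact n))
         = (1 + z / 2) ^ x * (1 - z / 2) ^ (N - x)"
  using theI'[OF krawtchouk_ex1[OF assms]] unfolding krawtchouk_def by blast

lemma krawtchouk_unique:
  fixes k :: "nat \<Rightarrow> real"
  assumes "x \<le> N" "n \<le> N"
    and "\<And>z::complex. (\<Sum>m = 0..N. complex_of_real (k m) * (z ^ m / fact m))
                      = (1 + z / 2) ^ x * (1 - z / 2) ^ (N - x)"
  shows "k n = krawtchouk N n x"
  by (rule generating_coeffs_eqI[where N = N])
     (simp_all only: assms krawtchouk_generating_function[OF \<open>x \<le> N\<close>])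

end

theory Submission
  imports Defs
begin

text \<open>
  By the binomial theorem, applying \<open>Lambda_hat N\<close> to the generating function
  \<open>(1 + z/2)^y (1 - z/2)^(N - y)\<close> averages the factors \<open>1 + z/2\<close> and \<open>1 - z/2\<close> to \<open>1\<close> and
  leaves \<open>(1 + z/2)^x\<close>; the coefficients of \<open>z^n\<close> give the action on the Krawtchouk vectors.
  The intertwining relation is checked entrywise: with \<open>M = N - x\<close> and \<open>y = x + j\<close>, both sides are
  multiples of \<open>x (C(M, j+1) - C(M, j))\<close>, by Pascal's rule on the left and the absorption
  identities for binomial coefficients on the right.
\<close>

text \<open>Collapses the sum over a subdiagonal in a row or over a superdiagonal in a column. For
  \<open>x = 0\<close> no index matches, although \<open>x - 1\<close> truncates to
  \<open>0\<close>.\<close>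

lemma sum_atMost_delta_shift:
  fixes f :: "nat \<Rightarrow> real"
  shows "(\<Sum>k\<le>N. if x = Suc k then f k else 0) = (if x = 0 \<or> x > Suc N then 0 else f (x - 1))"
  by (cases x) (simp_all add: sum.delta)

lemma dim_generator_mat [simp]:
  "dim_row (generator_mat N q) = N + 1" "dim_col (generator_mat N q) = N + 1"
  by (simp_all add: generator_mat_def)

lemma dim_Lambda_hat [simp]:
  "dim_row (Lambda_hat N) = N + 1" "dim_col (Lambda_hat N) = N + 1"
  by (simp_all add: Lambda_hat_def)

lemma index_mult_mat_sum:
  assumes "x < dim_row A" "y < dim_col B" "dim_col A = Suc N" "dim_row B = Suc N"
  shows "(A * B) $$ (x, y) = (\<Sum>k\<le>N. A $$ (x, k) * B $$ (k, y))"
  using assms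
  by (simp add: scalar_prod_def atLeast0LessThan lessThan_Suc_atMost del: sum.op_ivl_Suc sum.lessThan_Suc)

text \<open>One summand per diagonal, so that \<open>sum.distrib\<close> splits matrix products into
  delta sums.\<close>

lemma yule_generator_nth:
  assumes "x \<le> N" "y \<le> N"
  shows "yule_generator N $$ (x, y)
    = (if x = Suc y then real x else 0) + (if y = x then - real x else 0)"
proof -
  have "(\<Sum>y' \<in> {0..N} - {x}. if x = Suc y' then real x else 0)
      = (\<Sum>y'\<le>N. if x = Suc y' then real x else 0)"
    by (rule sum.mono_neutral_left) auto
  then show ?thesis
    using assms by (auto simp: yule_generator_def generator_mat_def sum_atMost_delta_shift)
qed

lemma ehrenfest_generator_nth:
  assumes "x \<le> N" "y \<le> N"
  shows "ehrenfest_generator N $$ (x, y)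
    = (if y = Suc x then (real N - real x) / 2 else 0) + (if x = Suc y then real x / 2 else 0)
      + (if x = y then - real N / 2 else 0)"
proof -
  have "(\<Sum>y' \<in> {0..N} - {x}. if y' = x + 1 then (real N - real x) / 2
            else if x = y' + 1 then real x / 2 else 0)
      = (\<Sum>y'\<le>N. (if y' = Suc x then (real N - real x) / 2 else 0)
            + (if x = Suc y' then real x / 2 else 0))"
    by (rule sum.mono_neutral_cong_left) auto
  \<comment> \<open>The two rates add up to \<open>N / 2\<close> at the ends as well, since the rate
    towards a missing neighbour is \<open>0\<close>.\<close>
  also have "\<dots> = real N / 2"
    using assms by (auto simp: sum.distrib sum.delta sum_atMost_delta_shift field_simps)
  finally show ?thesis
    using assms by (auto simp: ehrenfest_generator_def generator_mat_def)
qed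

lemma Lambda_hat_nth:
  assumes "x \<le> N" "y \<le> N"
  shows "Lambda_hat N $$ (x, y) = (if y < x then 0 else real ((N - x) choose (y - x)) / 2 ^ (N - x))"
proof -
  have "int x - int N = - int (N - x)"
    using assms by simp
  then have "(2::real) powi (int x - int N) = 1 / 2 ^ (N - x)"
    by (simp only: power_int_minus power_int_of_nat inverse_eq_divide)
  then show ?thesis
    using assms by (simp add: Lambda_hat_def)
qed

text \<open>Substituting \<open>y = x + j\<close> factors out \<open>a ^ x\<close> and leaves the
  binomial expansion of \<open>(a + b) ^ (N - x)\<close>. It serves real arguments for the row sums
  and complex ones for the generating function.\<close>

lemma sum_Lambda_hat_pow:
  fixes a b :: "'a :: real_field"
  assumes "x \<le> N"
  shows "(\<Sum>y = 0..N. of_real (Lambda_hat N $$ (x, y)) * (a ^ y * b ^ (N - y)))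
    = a ^ x * ((a + b) / 2) ^ (N - x)"
proof -
  have "(\<Sum>y = 0..N. of_real (Lambda_hat N $$ (x, y)) * (a ^ y * b ^ (N - y)))
      = (\<Sum>y = x..N. of_nat ((N - x) choose (y - x)) / 2 ^ (N - x) * (a ^ y * b ^ (N - y)))"
    using assms by (intro sum.mono_neutral_cong_right) (auto simp: Lambda_hat_nth)
  also have "\<dots> = (\<Sum>j\<le>N - x. of_nat ((N - x) choose j) / 2 ^ (N - x) * (a ^ (x + j) * b ^ (N - x - j)))"
    using assms by (intro sum.reindex_bij_witness[of _ "\<lambda>j. x + j" "\<lambda>y. y - x"]) auto
  also have "\<dots> = a ^ x / 2 ^ (N - x) * (a + b) ^ (N - x)"
    unfolding binomial_ring by (simp add: sum_distrib_left power_add mult_ac)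
  finally show ?thesis
    by (simp add: power_divide)
qed

lemma markov_kernel_Lambda_hat: "markov_kernel N (Lambda_hat N)"
proof -
  have "(\<Sum>y = 0..N. Lambda_hat N $$ (x, y)) = 1" if "x \<le> N" for x
    using sum_Lambda_hat_pow[OF that, of "1::real" 1] by simp
  then show ?thesis
    by (auto simp: markov_kernel_def Lambda_hat_nth)
qed

lemma Lambda_hat_krawtchouk:
  assumes "x \<le> N" "n \<le> N"
  shows "(\<Sum>y = 0..N. Lambda_hat N $$ (x, y) * krawtchouk N n y) = fact n * real (x choose n) / 2 ^ n"
\<comment> \<open>The rule replaces the claim for a single \<open>n\<close> by an identity of
  generating functions in \<open>z\<close>.\<close>
proof (rule generating_coeffs_eqI[OF _ \<open>n \<le> N\<close>])
  fix z :: complex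
  have "(\<Sum>m = 0..N. complex_of_real (\<Sum>y = 0..N. Lambda_hat N $$ (x, y) * krawtchouk N m y)
           * (z ^ m / fact m))
      = (\<Sum>m = 0..N. \<Sum>y = 0..N. of_real (Lambda_hat N $$ (x, y))
           * (of_real (krawtchouk N m y) * (z ^ m / fact m)))"
    by (simp only: of_real_sum of_real_mult sum_distrib_right mult.assoc)
  also have "\<dots> = (\<Sum>y = 0..N. of_real (Lambda_hat N $$ (x, y))
           * (\<Sum>m = 0..N. of_real (krawtchouk N m y) * (z ^ m / fact m)))"
    by (subst sum.swap) (simp only: sum_distrib_left)
  also have "\<dots> = (\<Sum>y = 0..N. of_real (Lambda_hat N $$ (x, y)) * ((1 + z / 2) ^ y * (1 - z / 2) ^ (N - y)))"
    by (intro sum.cong refl) (simp only: krawtchouk_generating_function atLeastAtMost_iff)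
  also have "\<dots> = (z / 2 + 1) ^ x"
    by (subst sum_Lambda_hat_pow[OF \<open>x \<le> N\<close>]) (simp add: add.commute)
  also have "\<dots> = (\<Sum>m\<le>x. of_nat (x choose m) * (z / 2) ^ m)"
    by (simp add: binomial_ring)
  also have "\<dots> = (\<Sum>m = 0..N. of_nat (x choose m) * (z / 2) ^ m)"
    using \<open>x \<le> N\<close> by (intro sum.mono_neutral_left) (auto simp: binomial_eq_0)
  also have "\<dots> = (\<Sum>m = 0..N. complex_of_real (fact m * real (x choose m) / 2 ^ m) * (z ^ m / fact m))"
    by (simp add: power_divide mult_ac)
  finally show "(\<Sum>m = 0..N. complex_of_real (\<Sum>y = 0..N. Lambda_hat N $$ (x, y) * krawtchouk N m y)
           * (z ^ m / fact m)) = \<dots>" .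
qed

lemma Lambda_hat_krawtchouk_vec:
  assumes "n \<le> N"
  shows "Lambda_hat N *\<^sub>v krawtchouk_vec N n
    = (2 powi (- int n) * fact n) \<cdot>\<^sub>v binomial_vec N n"
proof (rule eq_vecI)
  fix x
  assume "x < dim_vec ((2 powi (- int n) * fact n) \<cdot>\<^sub>v binomial_vec N n)"
  then have x: "x \<le> N"
    by (simp add: binomial_vec_def)
  have "(Lambda_hat N *\<^sub>v krawtchouk_vec N n) $ x
      = (\<Sum>y = 0..N. Lambda_hat N $$ (x, y) * krawtchouk N n y)"
    using x by (simp add: scalar_prod_def krawtchouk_vec_def atLeastLessThanSuc_atLeastAtMost
        del: sum.op_ivl_Suc)
  also have "\<dots> = ((2 powi (- int n) * fact n) \<cdot>\<^sub>v binomial_vec N n) $ x"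
    using x Lambda_hat_krawtchouk[OF x assms]
    by (simp add: binomial_vec_def power_int_minus field_simps)
  finally show "(Lambda_hat N *\<^sub>v krawtchouk_vec N n) $ x
      = ((2 powi (- int n) * fact n) \<cdot>\<^sub>v binomial_vec N n) $ x" .
qed (simp add: binomial_vec_def)

text \<open>Both sides equal \<open>M\<close> times the generalized binomial coefficient of
  \<open>M - 1\<close> over \<open>j\<close>. With real subtraction this covers
  \<open>j > M\<close>, where both sides are \<open>0\<close>.\<close>

lemma binomial_Suc_absorb_real:
  "real (M choose Suc j) * (real j + 1) = real (M choose j) * (real M - real j)"
  using gbinomial_absorption[of j "real M"] gbinomial_absorb_comp[of "real M" j]
  by (simp add: binomial_gbinomial mult.commute add.commute)

text \<open>At \<open>x = 0\<close> the truncated index \<open>x - 1\<close> is harmless because of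
  the factor \<open>real x\<close>.\<close>

lemma yule_Lambda_hat_nth:
  assumes "x \<le> N" "y \<le> N"
  shows "(yule_generator N * Lambda_hat N) $$ (x, y)
    = real x * (Lambda_hat N $$ (x - 1, y) - Lambda_hat N $$ (x, y))"
proof -
  have "(yule_generator N * Lambda_hat N) $$ (x, y)
      = (\<Sum>k\<le>N. yule_generator N $$ (x, k) * Lambda_hat N $$ (k, y))"
    using assms by (intro index_mult_mat_sum) (simp_all add: yule_generator_def)
  also have "\<dots> = (\<Sum>k\<le>N. (if x = Suc k then real x * Lambda_hat N $$ (k, y) else 0)
      + (if k = x then - real x * Lambda_hat N $$ (k, y) else 0))"
    using assms by (intro sum.cong) (auto simp: yule_generator_nth)
  also have "\<dots> = real x * (Lambda_hat N $$ (x - 1, y) - Lambda_hat N $$ (x, y))"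
    using assms by (simp add: sum.distrib sum.delta sum_atMost_delta_shift algebra_simps)
  finally show ?thesis .
qed

text \<open>The product runs down column \<open>y\<close> of the generator, so the rates are those
  of jumps into \<open>y\<close> from its neighbours; the guards drop neighbours outside the
  range.\<close>

lemma Lambda_hat_ehrenfest_nth:
  assumes "x \<le> N" "y \<le> N"
  shows "(Lambda_hat N * ehrenfest_generator N) $$ (x, y)
    = (if y = 0 then 0 else Lambda_hat N $$ (x, y - 1) * (real N - real (y - 1)) / 2)
      + (if y = N then 0 else Lambda_hat N $$ (x, Suc y) * real (Suc y) / 2)
      - Lambda_hat N $$ (x, y) * real N / 2"
proof -
  have "(Lambda_hat N * ehrenfest_generator N) $$ (x, y)
      = (\<Sum>k\<le>N. Lambda_hat N $$ (x, k) * ehrenfest_generator N $$ (k, y))"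
    using assms by (intro index_mult_mat_sum) (simp_all add: ehrenfest_generator_def)
  also have "\<dots> = (\<Sum>k\<le>N. (if y = Suc k then Lambda_hat N $$ (x, k) * (real N - real k) / 2 else 0)
      + (if k = Suc y then Lambda_hat N $$ (x, k) * real k / 2 else 0)
      + (if k = y then - Lambda_hat N $$ (x, k) * real N / 2 else 0))"
    using assms by (intro sum.cong) (auto simp: ehrenfest_generator_nth)
  also have "\<dots> = (if y = 0 then 0 else Lambda_hat N $$ (x, y - 1) * (real N - real (y - 1)) / 2)
      + (if y = N then 0 else Lambda_hat N $$ (x, Suc y) * real (Suc y) / 2)
      - Lambda_hat N $$ (x, y) * real N / 2"
    using assms by (auto simp: sum.distrib sum.delta sum_atMost_delta_shift)
  finally show ?thesis .
qed

lemma Lambda_hat_intertwining: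
  "yule_generator N * Lambda_hat N = Lambda_hat N * ehrenfest_generator N"
proof (rule eq_matI)
  fix x y
  assume "x < dim_row (Lambda_hat N * ehrenfest_generator N)"
    and "y < dim_col (Lambda_hat N * ehrenfest_generator N)"
  then have x: "x \<le> N" and y: "y \<le> N"
    by (simp_all add: ehrenfest_generator_def)
  define M where "M = N - x"
  have N: "N = x + M"
    using x by (simp add: M_def)
  \<comment> \<open>In the first case everything vanishes; in the second only the entries
    \<open>(x - 1, y)\<close> on the left and \<open>(x, Suc y)\<close> on the right
    survive.\<close>
  consider "Suc y < x" | "Suc y = x" | "x \<le> y"
    by linarith
  then show "(yule_generator N * Lambda_hat N) $$ (x, y)
      = (Lambda_hat N * ehrenfest_generator N) $$ (x, y)"
  proof cases
    case 1
    then show ?thesis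
      using x y by (auto simp: yule_Lambda_hat_nth Lambda_hat_ehrenfest_nth Lambda_hat_nth)
  next
    case 2
    then have "N - y = Suc M"
      using N by simp
    with 2 show ?thesis
      using x y by (auto simp: yule_Lambda_hat_nth Lambda_hat_ehrenfest_nth Lambda_hat_nth
          M_def[symmetric])
  next
    case 3
    then obtain j where y_eq: "y = x + j"
      using le_Suc_ex by blast
    have diag: "Lambda_hat N $$ (x, y) = real (M choose j) / 2 ^ M"
      using x y y_eq by (simp add: Lambda_hat_nth M_def)
    have lhs: "(yule_generator N * Lambda_hat N) $$ (x, y)
        = real x * (real (M choose Suc j) - real (M choose j)) / (2 * 2 ^ M)"
    proof (cases x)
      case 0
      then show ?thesis
        using y by (simp add: yule_Lambda_hat_nth)
    next
      case (Suc x')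
      then have idx: "\<not> y < x - 1" "N - (x - 1) = Suc M" "y - (x - 1) = Suc j"
        using N y_eq by simp_all
      have up: "Lambda_hat N $$ (x - 1, y) = real (Suc M choose Suc j) / 2 ^ Suc M"
        using x y y_eq idx by (simp add: Lambda_hat_nth del: binomial_Suc_Suc power_Suc)
      \<comment> \<open>Pascal's rule over the common denominator \<open>2 ^ Suc M\<close> turns one
        of the two copies of \<open>M choose j\<close> into \<open>M choose Suc j\<close>.\<close>
      show ?thesis
        unfolding yule_Lambda_hat_nth[OF x y] diag up by (simp add: field_simps)
    qed
    \<comment> \<open>Absorption with \<open>i = j - 1\<close>, as
      \<open>N - (y - 1) = M - i\<close>; for \<open>j = 0\<close> the entry lies below the
      diagonal.\<close>
    have left: "(if y = 0 then 0 else Lambda_hat N $$ (x, y - 1) * (real N - real (y - 1)) / 2)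
        = real (M choose j) * real j / (2 * 2 ^ M)"
    proof (cases j)
      case 0
      then show ?thesis
        using x y y_eq by (auto simp: Lambda_hat_nth)
    next
      case (Suc i)
      then show ?thesis
        using x y y_eq N binomial_Suc_absorb_real[of M i]
        by (simp add: Lambda_hat_nth M_def[symmetric] add.commute)
    qed
    \<comment> \<open>Split \<open>Suc y\<close> as \<open>x + Suc j\<close> and absorb only the
      part \<open>Suc j\<close>. At \<open>y = N\<close> one has \<open>j = M\<close>, and both
      terms vanish.\<close>
    have right: "(if y = N then 0 else Lambda_hat N $$ (x, Suc y) * real (Suc y) / 2)
        = (real (M choose j) * (real M - real j) + real (M choose Suc j) * real x) / (2 * 2 ^ M)"
    proof (cases "y = N")
      case True
      then show ?thesis
        using N y_eq by simp
    next
      case False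
      then have "Lambda_hat N $$ (x, Suc y) = real (M choose Suc j) / 2 ^ M"
        using x y y_eq by (simp add: Lambda_hat_nth M_def[symmetric])
      with False show ?thesis
        unfolding binomial_Suc_absorb_real[symmetric] by (simp add: y_eq algebra_simps)
    qed
    \<comment> \<open>The multiples \<open>j\<close> and \<open>M - j\<close> of
      \<open>M choose j\<close> add up to \<open>M\<close>; subtracting \<open>N = x + M\<close>
      leaves \<open>- x\<close>.\<close>
    show ?thesis
      unfolding lhs Lambda_hat_ehrenfest_nth[OF x y] left right diag
      by (simp add: N field_simps)
  qed
qed (simp_all add: yule_generator_def ehrenfest_generator_def)

theorem proposition9:
  fixes N :: nat
  shows "markov_kernel N (Lambda_hat N)
    \<and> (\<forall>n\<in>{0..N}. Lambda_hat N *\<^sub>v krawtchouk_vec N n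
          = (2 powi (- int n) * fact n) \<cdot>\<^sub>v binomial_vec N n)
    \<and> yule_generator N * Lambda_hat N = Lambda_hat N * ehrenfest_generator N"
  by (simp add: markov_kernel_Lambda_hat Lambda_hat_krawtchouk_vec Lambda_hat_intertwining)

end
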